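(* Let $\boldsymbol{\alpha},\boldsymbol{\beta},\boldsymbol{\gamma}$ be weakly decreasing $n$-tuples of positive real numbers. Horn's multiplicative problem is solvable for $(\boldsymbol{\alpha},\boldsymbol{\beta},\boldsymbol{\gamma})$ if and only if there is an $F\in\mathcal{H}_n$ with $\partial F=(\boldsymbol{\alpha},\boldsymbol{\beta},\boldsymbol{\gamma})$; in other words, if and only if there is a Vinnikov curve $\{F=0\}$ of degree $n$ passing (with multiplicities counted on each coordinate line) through the points $(-1:\alpha_i^2:0)$, $(0:-1:\beta_i^2)$ and $(\gamma_i^2:0:-1)$, $1\le i\le n$.
   Context: $\mathcal{H}_n\subset\mathbb{R}[x,y,z]$ is the set of homogeneous degree $n$ polynomials of the form $F=\det(xX+yY+zZ)$ with $X,Y,Z$ positive definite Hermitian complex $n\times n$ matrices (considered up to nonzero real scalars when convenient). A Vinnikov curve is a projective plane curve given by such an $F$. For $F\in\mathcal{H}_n$, the polynomials $F(-1,u,0)$, $F(0,-1,u)$, $F(u,0,-1)$ in $u$ have $n$ positive real zeros (with multiplicity), and $\partial F$ denotes the triple of weakly decreasing $n$-tuples of positive reals consisting of the positive square roots of the zeros (with multiplicity) of $F(-1,u,0)$, $F(0,-1,u)$ and $F(u,0,-1)$ respectively. The singular values of a matrix $A\in\mathrm{Mat}_n(\mathbb{C})$ are the positive square roots of the eigenvalues of $A^*A$, where $A^*$ is the conjugate transpose. Horn's multiplicative problem is solvable for $(\boldsymbol{\alpha},\boldsymbol{\beta},\boldsymbol{\gamma})$ if there exist invertible complex $n\times n$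 matrices $A,B,C$ with $ABC=1$ whose singular values (with multiplicity) are $\boldsymbol{\alpha}$, $\boldsymbol{\beta}$, $\boldsymbol{\gamma}$ respectively. *)

theory Defs
  imports
    "HOL-Library.Poly_Mapping"
    "HOL-Library.Product_Plus"
    "HOL-Computational_Algebra.Polynomial"
    "Jordan_Normal_Form.Char_Poly"
    "Jordan_Normal_Form.Schur_Decomposition"
begin

section \<open>Polynomials in three variables\<close>

text \<open>
  The polynomial ring $R[x,y,z]$ is the monoid algebra of exponent triples: the coefficient of
  $x^i y^j z^k$ in \<open>F\<close> is \<open>Poly_Mapping.lookup F (i, j, k)\<close>.
\<close>

type_synonym 'a poly3 = "nat \<times> nat \<times> nat \<Rightarrow>\<^sub>0 'a"

definition const3 :: "'a::zero \<Rightarrow> 'a poly3" where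
  "const3 c = Poly_Mapping.single (0, 0, 0) c"

definition var_x :: "'a::zero_neq_one poly3" where
  "var_x = Poly_Mapping.single (1, 0, 0) 1"

definition var_y :: "'a::zero_neq_one poly3" where
  "var_y = Poly_Mapping.single (0, 1, 0) 1"

definition var_z :: "'a::zero_neq_one poly3" where
  "var_z = Poly_Mapping.single (0, 0, 1) 1"

definition homogeneous3 :: "nat \<Rightarrow> 'a::zero poly3 \<Rightarrow> bool" where
  "homogeneous3 n F \<longleftrightarrow> (\<forall>(i, j, k) \<in> Poly_Mapping.keys F. i + j + k = n)"

text \<open>The univariate polynomial $F(p,q,r)$ obtained by substituting univariate polynomials.\<close>

definition subst3 ::
  "'a::comm_semiring_1 poly3 \<Rightarrow> 'a poly \<Rightarrow> 'a poly \<Rightarrow> 'a poly \<Rightarrow> 'a poly" where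
  "subst3 F p q r =
     (\<Sum>(i, j, k) \<in> Poly_Mapping.keys F.
        Polynomial.smult (Poly_Mapping.lookup F (i, j, k)) (p ^ i * q ^ j * r ^ k))"


section \<open>Determinantal polynomials\<close>

text \<open>
  \<open>(A *\<^sub>v v) \<bullet>c v\<close> is $v^* A v$, which is real because \<open>A\<close> is Hermitian.
\<close>

definition pos_def_hermitian :: "nat \<Rightarrow> complex mat \<Rightarrow> bool" where
  "pos_def_hermitian n A \<longleftrightarrow>
     A \<in> carrier_mat n n \<and> mat_adjoint A = A \<and>
     (\<forall>v \<in> carrier_vec n. v \<noteq> 0\<^sub>v n \<longrightarrow> Re ((A *\<^sub>v v) \<bullet>c v) > 0)"

definition det_pencil :: "complex mat \<Rightarrow> complex mat \<Rightarrow> complex mat \<Rightarrow> complex poly3" where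
  "det_pencil X Y Z =
     det (var_x \<cdot>\<^sub>m map_mat const3 X + var_y \<cdot>\<^sub>m map_mat const3 Y + var_z \<cdot>\<^sub>m map_mat const3 Z)"

definition vinnikov_polys :: "nat \<Rightarrow> real poly3 set" where
  "vinnikov_polys n =
     {F. homogeneous3 n F \<and>
         (\<exists>X Y Z. pos_def_hermitian n X \<and> pos_def_hermitian n Y \<and> pos_def_hermitian n Z \<and>
            Poly_Mapping.map complex_of_real F = det_pencil X Y Z)}"

definition decreasing_list_of :: "real multiset \<Rightarrow> real list" where
  "decreasing_list_of M = rev (sorted_list_of_multiset M)"

definition sqrt_zeros :: "real poly \<Rightarrow> real list" where
  "sqrt_zeros p = decreasing_list_of (image_mset sqrt (proots p))"

definition boundary :: "real poly3 \<Rightarrow> real list \<times> real list \<times> real list" where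
  "boundary F =
     (let u = [:0, 1:] in
        (sqrt_zeros (subst3 F (-1) u 0),
         sqrt_zeros (subst3 F 0 (-1) u),
         sqrt_zeros (subst3 F u 0 (-1))))"


section \<open>Plane curves\<close>

text \<open>
  A plane curve is represented by an equation, which is determined up to a nonzero scalar; in
  particular multiple components are remembered. Points of the projective plane are represented
  by nonzero homogeneous coordinates.
\<close>

definition vinnikov_curve :: "nat \<Rightarrow> real poly3 \<Rightarrow> bool" where
  "vinnikov_curve n F \<longleftrightarrow> (\<exists>c G. c \<noteq> 0 \<and> G \<in> vinnikov_polys n \<and> F = const3 c * G)"

type_synonym point = "real \<times> real \<times> real"

definition proj_eq :: "point \<Rightarrow> point \<Rightarrow> bool" where
  "proj_eq p q \<longleftrightarrow>
     (\<exists>c. c \<noteq> 0 \<and> q = (c * fst p, c * fst (snd p), c * snd (snd p)))"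

text \<open>
  The intersection multiplicity at \<open>p\<close> of the curve $F = 0$ with the line joining \<open>p\<close> to a
  different point \<open>q\<close>: the order of vanishing at $t = 0$ of $F(p + tq)$. It depends on \<open>q\<close> only
  through the line. It is meaningful only if $F$ does not vanish identically on that line, which
  holds for Vinnikov curves and the coordinate lines.
\<close>

fun line_mult :: "real poly3 \<Rightarrow> point \<Rightarrow> point \<Rightarrow> nat" where
  "line_mult F (p1, p2, p3) (q1, q2, q3) =
     Polynomial.order 0 (subst3 F [:p1, q1:] [:p2, q2:] [:p3, q3:])"

text \<open>
  The points \<open>ps\<close> and \<open>q\<close> are meant to lie on a common line, with \<open>q\<close> different from all points
  in \<open>ps\<close>.
\<close>

definition passes_through_on_line :: "real poly3 \<Rightarrow> point \<Rightarrow> point list \<Rightarrow> bool" where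
  "passes_through_on_line F q ps \<longleftrightarrow>
     (\<forall>p \<in> set ps. line_mult F p q = length (filter (proj_eq p) ps))"


section \<open>Horn's multiplicative problem\<close>

definition singular_values :: "complex mat \<Rightarrow> real list" where
  "singular_values A =
     decreasing_list_of
       (image_mset (\<lambda>e. sqrt (Re e)) (proots (char_poly (mat_adjoint A * A))))"

definition horn_multiplicative_solvable ::
  "nat \<Rightarrow> real list \<Rightarrow> real list \<Rightarrow> real list \<Rightarrow> bool" where
  "horn_multiplicative_solvable n \<alpha> \<beta> \<gamma> \<longleftrightarrow>
     (\<exists>A B C. A \<in> carrier_mat n n \<and> B \<in> carrier_mat n n \<and> C \<in> carrier_mat n n \<and>
        invertible_mat A \<and> invertible_mat B \<and> invertible_mat C \<and>
        A * B * C = 1\<^sub>m n \<and>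
        singular_values A = \<alpha> \<and> singular_values B = \<beta> \<and> singular_values C = \<gamma>)"

definition decreasing_pos_tuple :: "nat \<Rightarrow> real list \<Rightarrow> bool" where
  "decreasing_pos_tuple n \<alpha> \<longleftrightarrow>
     length \<alpha> = n \<and> sorted_wrt (\<ge>) \<alpha> \<and> (\<forall>a \<in> set \<alpha>. a > 0)"

end

theory Submission
  imports Defs "HOL-Computational_Algebra.Fundamental_Theorem_Algebra"
begin

text \<open>
  A positive definite Hermitian matrix is the same thing as a Gram matrix \<open>P\<^sup>* P\<close> with \<open>P\<close>
  invertible (\<open>pos_def_hermitian_iff_gram\<close>). So the polynomials in question are the
  $F = \det(x P^*P + y Q^*Q + z R^*R)$, and the matrices $A = PQ^{-1}$, $B = QR^{-1}$, $C = RP^{-1}$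
  satisfy $ABC = 1$. On the coordinate line $z = 0$,
  $$F(-1,u,0) = \det(u Q^*Q - P^*P) = \det(Q^* (u - A^*A) Q) = |\det Q|^2 \det(u - A^*A),$$
  whose zeros are the squared singular values of \<open>A\<close>; the other two lines give those of \<open>B\<close> and
  \<open>C\<close> in the same way (\<open>boundary_gram_pencil\<close>). Conversely, three matrices with $ABC = 1$
  arise in this way from $P = AB$, $Q = B$, $R = 1$. This is the first equivalence.

  To stay within real polynomials one needs that the pencil determinant has real coefficients: conjugating
  them amounts to transposing the pencil (\<open>map_cnj_det_pencil\<close>). To pass from complex to real
  zeros one needs that the eigenvalues of $A^*A$ are real (\<open>char_poly_gram_root_real\<close>).

  For the second equivalence, the restriction of \<open>F\<close> to a coordinate line is a polynomial of
  degree exactly \<open>n\<close>. If each $\alpha_i^2$ is a zero of it whose order is the number of times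
  it is listed, then the list already accounts for \<open>n\<close> zeros, so there are no others
  (\<open>sqrt_zeros_eq_iff_order\<close>). Intersection multiplicities are insensitive to scaling the
  equation, so it does not matter that the curve determines \<open>F\<close> only up to a scalar.
\<close>


section \<open>Substitution, conjugation and homogeneity of ternary polynomials\<close>

lemma poly_mapping_eq_sum_single:
  "f = (\<Sum>k\<in>Poly_Mapping.keys f. Poly_Mapping.single k (Poly_Mapping.lookup f k))"
proof (rule poly_mapping_eqI)
  fix k
  have "Poly_Mapping.lookup (\<Sum>l\<in>Poly_Mapping.keys f. Poly_Mapping.single l (Poly_Mapping.lookup f l)) k
      = (\<Sum>l\<in>Poly_Mapping.keys f. if l = k then Poly_Mapping.lookup f l else 0)"
    by (auto simp: lookup_sum lookup_single when_def intro!: sum.cong)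
  also have "\<dots> = Poly_Mapping.lookup f k"
    by (simp add: in_keys_iff)
  finally show "Poly_Mapping.lookup f k = Poly_Mapping.lookup
      (\<Sum>l\<in>Poly_Mapping.keys f. Poly_Mapping.single l (Poly_Mapping.lookup f l)) k" ..
qed

lemma additive_sum:
  assumes "\<And>f g. h (f + g) = h f + h g" and "h 0 = 0"
  shows "h (\<Sum>i\<in>I. f i) = (\<Sum>i\<in>I. h (f i))"
  by (induction I rule: infinite_finite_induct) (simp_all add: assms)

text \<open>
  Every element is a sum of monomials, so by distributivity multiplicativity is only a question
  about monomials. Both substitution and coefficientwise conjugation are covered by this.
\<close>

lemma mult_hom_if_mult_hom_single:
  fixes h :: "('a::comm_monoid_add \<Rightarrow>\<^sub>0 'b::comm_semiring_0) \<Rightarrow> 'c::comm_semiring_0"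
  assumes add: "\<And>f g. h (f + g) = h f + h g" and zero: "h 0 = 0"
    and single: "\<And>k l a b. h (Poly_Mapping.single k a * Poly_Mapping.single l b) =
      h (Poly_Mapping.single k a) * h (Poly_Mapping.single l b)"
  shows "h (f * g) = h f * h g"
proof -
  let ?s = "\<lambda>f k. Poly_Mapping.single k (Poly_Mapping.lookup f k)"
  have "h (f * g) = h ((\<Sum>k\<in>Poly_Mapping.keys f. ?s f k) * (\<Sum>l\<in>Poly_Mapping.keys g. ?s g l))"
    by (simp flip: poly_mapping_eq_sum_single)
  also have "\<dots> = (\<Sum>k\<in>Poly_Mapping.keys f. \<Sum>l\<in>Poly_Mapping.keys g. h (?s f k) * h (?s g l))"
    by (simp only: sum_product additive_sum[of h, OF add zero] single)
  also have "\<dots> = h (\<Sum>k\<in>Poly_Mapping.keys f. ?s f k) * h (\<Sum>l\<in>Poly_Mapping.keys g. ?s g l)"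
    by (simp only: sum_product additive_sum[of h, OF add zero])
  also have "\<dots> = h f * h g"
    by (simp flip: poly_mapping_eq_sum_single)
  finally show ?thesis .
qed

text \<open>
  Summing over a common superset of the supports makes \<open>subst3\<close> visibly additive, although its
  own range of summation changes with the polynomial.
\<close>

lemma subst3_superset:
  assumes "finite K" "Poly_Mapping.keys F \<subseteq> K"
  shows "subst3 F p q r =
    (\<Sum>(i, j, k) \<in> K. Polynomial.smult (Poly_Mapping.lookup F (i, j, k)) (p ^ i * q ^ j * r ^ k))"
  unfolding subst3_def using assms
  by (intro sum.mono_neutral_left) (auto simp: in_keys_iff)

lemma subst3_0 [simp]: "subst3 0 p q r = 0"
  by (simp add: subst3_def)

lemma subst3_single:
  "subst3 (Poly_Mapping.single (i, j, k) a) p q r = Polynomial.smult a (p ^ i * q ^ j * r ^ k)"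
  by (cases "a = 0") (simp_all add: subst3_def)

lemma subst3_add: "subst3 (F + G) p q r = subst3 F p q r + subst3 G p q r"
proof -
  let ?K = "Poly_Mapping.keys F \<union> Poly_Mapping.keys G"
  have "finite ?K" "Poly_Mapping.keys (F + G) \<subseteq> ?K"
    "Poly_Mapping.keys F \<subseteq> ?K" "Poly_Mapping.keys G \<subseteq> ?K"
    using keys_add[of F G] by auto
  then show ?thesis
    by (simp only: subst3_superset[of ?K] lookup_add smult_add_left case_prod_unfold sum.distrib)
qed

lemma subst3_mult: "subst3 (F * G) p q r = subst3 F p q r * subst3 G p q r"
proof (rule mult_hom_if_mult_hom_single[of "\<lambda>F. subst3 F p q r"])
  fix k l :: "nat \<times> nat \<times> nat" and a b :: 'a
  show "subst3 (Poly_Mapping.single k a * Poly_Mapping.single l b) p q r =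
      subst3 (Poly_Mapping.single k a) p q r * subst3 (Poly_Mapping.single l b) p q r"
    by (cases k; cases l) (simp add: mult_single subst3_single power_add mult_ac)
qed (simp_all add: subst3_add)

lemma subst3_const3: "subst3 (const3 c) p q r = [:c:]"
  by (simp add: const3_def subst3_single)

lemma subst3_var:
  "subst3 var_x p q r = p" "subst3 var_y p q r = q" "subst3 var_z p q r = r"
  by (simp_all add: var_x_def var_y_def var_z_def subst3_single)

text \<open>
  Being a ring homomorphism, substitution commutes with determinants.
\<close>

lemma subst3_hom: "comm_ring_hom (\<lambda>F::'a::comm_ring_1 poly3. subst3 F p q r)"
proof unfold_locales
  have "subst3 (1 :: 'a poly3) p q r = subst3 (const3 1) p q r"
    unfolding const3_def zero_prod_def[symmetric] by simp
  then show "subst3 (1 :: 'a poly3) p q r = 1"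
    by (simp add: subst3_const3)
qed (simp_all add: subst3_add subst3_mult)

lemma lookup_map_hom:
  "f 0 = 0 \<Longrightarrow> Poly_Mapping.lookup (Poly_Mapping.map f F) k = f (Poly_Mapping.lookup F k)"
  by (simp add: map.rep_eq when_def)

lemma map_cnj_hom: "comm_ring_hom (Poly_Mapping.map cnj :: complex poly3 \<Rightarrow> complex poly3)"
proof unfold_locales
  show zero: "Poly_Mapping.map cnj 0 = (0 :: complex poly3)"
    by (rule poly_mapping_eqI) (simp add: lookup_map_hom)
  show "Poly_Mapping.map cnj 1 = (1 :: complex poly3)"
    by (rule poly_mapping_eqI) (simp add: lookup_map_hom lookup_one when_def)
  show add: "Poly_Mapping.map cnj (F + G) = Poly_Mapping.map cnj F + Poly_Mapping.map cnj G"
    for F G :: "complex poly3"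
    by (rule poly_mapping_eqI) (simp add: lookup_map_hom lookup_add)
  show "Poly_Mapping.map cnj (F * G) = Poly_Mapping.map cnj F * Poly_Mapping.map cnj G"
    for F G :: "complex poly3"
    by (rule mult_hom_if_mult_hom_single[of "Poly_Mapping.map cnj"])
      (simp_all add: add zero mult_single)
qed

lemma subst3_map_of_real:
  "subst3 (Poly_Mapping.map complex_of_real F)
     (map_poly complex_of_real p) (map_poly complex_of_real q) (map_poly complex_of_real r) =
   map_poly complex_of_real (subst3 F p q r)"
proof -
  interpret map_poly_inj_comm_ring_hom complex_of_real
    by unfold_locales auto
  have "Poly_Mapping.keys (Poly_Mapping.map complex_of_real F) = Poly_Mapping.keys F"
    by (auto simp: in_keys_iff lookup_map_hom)
  then show ?thesis
    by (simp add: subst3_def hom_distribs case_prod_unfold lookup_map_hom)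
qed

lemma homogeneous3_add: "homogeneous3 n F \<Longrightarrow> homogeneous3 n G \<Longrightarrow> homogeneous3 n (F + G)"
  using keys_add[of F G] by (auto simp: homogeneous3_def)

lemma homogeneous3_sum: "(\<And>i. i \<in> I \<Longrightarrow> homogeneous3 n (F i)) \<Longrightarrow> homogeneous3 n (\<Sum>i\<in>I. F i)"
  by (induction I rule: infinite_finite_induct)
    (auto simp: homogeneous3_add, simp_all add: homogeneous3_def)

lemma homogeneous3_mult:
  assumes F: "homogeneous3 m F" and G: "homogeneous3 n G"
  shows "homogeneous3 (m + n) (F * G)"
  unfolding homogeneous3_def
proof clarify
  fix i j k
  assume "(i, j, k) \<in> Poly_Mapping.keys (F * G)"
  then obtain s t where st: "s \<in> Poly_Mapping.keys F" "t \<in> Poly_Mapping.keys G"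
    and "(i, j, k) = s + t"
    using keys_mult[of F G] by blast
  moreover obtain a b c a' b' c' where "s = (a, b, c)" "t = (a', b', c')"
    by (metis prod_cases3)
  moreover have "a + b + c = m" "a' + b' + c' = n"
    using F G st calculation unfolding homogeneous3_def by blast+
  ultimately show "i + j + k = m + n" by simp
qed

lemma homogeneous3_const3: "homogeneous3 0 (const3 c)"
  by (cases "c = 0") (auto simp: homogeneous3_def const3_def)

lemma homogeneous3_1: "homogeneous3 0 (1 :: 'a::comm_semiring_1 poly3)"
  by (simp add: homogeneous3_def zero_prod_def)

lemma homogeneous3_prod:
  fixes F :: "'i \<Rightarrow> 'a::comm_semiring_1 poly3"
  shows "(\<And>i. i \<in> I \<Longrightarrow> homogeneous3 1 (F i)) \<Longrightarrow> finite I \<Longrightarrow> homogeneous3 (card I) (\<Prod>i\<in>I. F i)"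
proof (induction I rule: infinite_finite_induct)
  case (insert i I)
  have "homogeneous3 (1 + card I) (F i * prod F I)"
    using insert by (intro homogeneous3_mult) auto
  then show ?case using insert by simp
qed (simp_all add: homogeneous3_1)

lemma homogeneous3_var:
  "homogeneous3 1 (var_x :: 'a::zero_neq_one poly3)" "homogeneous3 1 (var_y :: 'a poly3)"
  "homogeneous3 1 (var_z :: 'a poly3)"
  by (simp_all add: homogeneous3_def var_x_def var_y_def var_z_def)

section \<open>Positive definite matrices as Gram matrices\<close>

lemma mat_adjoint_eq: "mat_adjoint A = transpose_mat (map_mat cnj A)"
  by (rule eq_matI) (auto simp: mat_adjoint_def mat_of_rows_def)

lemma mat_adjoint_carrier [simp]:
  "A \<in> carrier_mat m n \<Longrightarrow> mat_adjoint A \<in> carrier_mat n m" for A :: "complex mat"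
  by (simp add: mat_adjoint_eq)

lemma mat_adjoint_index [simp]:
  "i < dim_col A \<Longrightarrow> j < dim_row A \<Longrightarrow> mat_adjoint A $$ (i, j) = cnj (A $$ (j, i))"
  by (simp add: mat_adjoint_eq)

lemma mat_adjoint_mult:
  fixes A :: "complex mat"
  assumes "A \<in> carrier_mat l m" "B \<in> carrier_mat m n"
  shows "mat_adjoint (A * B) = mat_adjoint B * mat_adjoint A"
proof -
  interpret cnj: comm_ring_hom cnj by unfold_locales auto
  show ?thesis
    unfolding mat_adjoint_eq cnj.mat_hom_mult[OF assms]
    by (rule transpose_mult) (use assms in auto)
qed

lemma mat_adjoint_adjoint [simp]: "mat_adjoint (mat_adjoint A) = A" for A :: "complex mat"
  by (rule eq_matI) (auto simp: mat_adjoint_eq)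

lemma det_mat_adjoint:
  assumes "A \<in> carrier_mat n n"
  shows "det (mat_adjoint A) = cnj (det A)"
proof -
  interpret cnj: comm_ring_hom cnj by unfold_locales auto
  show ?thesis
    using assms by (simp add: mat_adjoint_eq det_transpose[of _ n])
qed

lemma gram_carrier [simp]:
  "A \<in> carrier_mat n n \<Longrightarrow> mat_adjoint A * A \<in> carrier_mat n n" for A :: "complex mat"
  by (rule mult_carrier_mat[of _ n n]) auto

lemma cscalar_prod_adjoint:
  fixes A :: "complex mat"
  assumes A: "A \<in> carrier_mat m n" and v: "v \<in> carrier_vec m" and w: "w \<in> carrier_vec n"
  shows "(mat_adjoint A *\<^sub>v v) \<bullet>c w = v \<bullet>c (A *\<^sub>v w)"
proof -
  have "(mat_adjoint A *\<^sub>v v) \<bullet>c w =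
      (\<Sum>i\<in>{0..<n}. \<Sum>j\<in>{0..<m}. cnj (A $$ (j, i)) * v $ j * cnj (w $ i))"
    using assms by (auto simp: scalar_prod_def mat_adjoint_eq sum_distrib_right intro!: sum.cong)
  also have "\<dots> = (\<Sum>j\<in>{0..<m}. \<Sum>i\<in>{0..<n}. cnj (A $$ (j, i)) * v $ j * cnj (w $ i))"
    by (rule sum.swap)
  also have "\<dots> = v \<bullet>c (A *\<^sub>v w)"
    using assms by (auto simp: scalar_prod_def sum_distrib_left mult_ac intro!: sum.cong)
  finally show ?thesis .
qed

lemma cscalar_prod_self:
  fixes v :: "complex vec"
  assumes "v \<in> carrier_vec n" "v \<noteq> 0\<^sub>v n"
  shows "Im (v \<bullet>c v) = 0" "Re (v \<bullet>c v) > 0"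
  using conjugate_square_greater_0_vec[OF assms(1)] assms(2) by (auto simp: less_complex_def)

lemma pos_def_hermitian_gram:
  assumes P: "P \<in> carrier_mat n n" and det: "det P \<noteq> 0"
  shows "pos_def_hermitian n (mat_adjoint P * P)"
  unfolding pos_def_hermitian_def
proof (intro conjI ballI impI)
  show "mat_adjoint (mat_adjoint P * P) = mat_adjoint P * P"
    using P by (subst mat_adjoint_mult[of _ n n]) auto
next
  fix v :: "complex vec" assume v: "v \<in> carrier_vec n" "v \<noteq> 0\<^sub>v n"
  have "((mat_adjoint P * P) *\<^sub>v v) \<bullet>c v = (P *\<^sub>v v) \<bullet>c (P *\<^sub>v v)"
    using P v by (subst assoc_mult_mat_vec[of _ n n _ n]) (auto simp: cscalar_prod_adjoint[of _ n n])
  moreover have "P *\<^sub>v v \<noteq> 0\<^sub>v n"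
    using det det_0_iff_vec_prod_zero[OF P] v by blast
  ultimately show "Re (((mat_adjoint P * P) *\<^sub>v v) \<bullet>c v) > 0"
    using cscalar_prod_self(2)[of "P *\<^sub>v v" n] P v by simp
qed (use P in auto)

lemma pos_def_hermitian_index:
  assumes "pos_def_hermitian n X" "i < n" "j < n"
  shows "X $$ (i, j) = cnj (X $$ (j, i))"
proof -
  have "X \<in> carrier_mat n n" "mat_adjoint X = X"
    using assms by (auto simp: pos_def_hermitian_def)
  then show ?thesis
    using mat_adjoint_index[of i X j] assms by simp
qed

lemma pos_def_hermitian_corner:
  assumes "pos_def_hermitian (Suc n) X"
  shows "Im (X $$ (0, 0)) = 0" "Re (X $$ (0, 0)) > 0"
proof -
  have "cnj (X $$ (0, 0)) = X $$ (0, 0)"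
    using pos_def_hermitian_index[OF assms, of 0 0] by simp
  then show "Im (X $$ (0, 0)) = 0" by (metis Reals_cnj_iff complex_is_Real_iff)
  let ?e = "unit_vec (Suc n) 0 :: complex vec"
  have X: "X \<in> carrier_mat (Suc n) (Suc n)" using assms by (simp add: pos_def_hermitian_def)
  have "(X *\<^sub>v ?e) \<bullet>c ?e = X $$ (0, 0)"
  proof -
    have "conjugate ?e = ?e" by (rule eq_vecI) (auto simp: unit_vec_def)
    then show ?thesis using X by (simp add: scalar_prod_right_unit)
  qed
  moreover have "?e \<in> carrier_vec (Suc n)" "?e \<noteq> 0\<^sub>v (Suc n)" by auto
  ultimately show "Re (X $$ (0, 0)) > 0"
    using assms unfolding pos_def_hermitian_def by metis
qed

definition schur_complement :: "complex mat \<Rightarrow> nat \<Rightarrow> complex mat" where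
  "schur_complement X n =
     mat n n (\<lambda>(i, j). X $$ (Suc i, Suc j) - X $$ (Suc i, 0) * X $$ (0, Suc j) / X $$ (0, 0))"

text \<open>
  A vector \<open>v\<close> is prolonged by the first coordinate for which the first entry of \<open>X w\<close>
  vanishes; the other entries of \<open>X w\<close> are then those of the Schur complement applied to \<open>v\<close>,
  so both Hermitian forms have the same value.
\<close>

lemma pos_def_hermitian_schur_complement:
  assumes pd: "pos_def_hermitian (Suc n) X"
  shows "pos_def_hermitian n (schur_complement X n)"
  unfolding pos_def_hermitian_def
proof (intro conjI ballI impI)
  let ?Y = "schur_complement X n"
  have X: "X \<in> carrier_mat (Suc n) (Suc n)" using pd by (simp add: pos_def_hermitian_def)
  have a0: "X $$ (0, 0) \<noteq> 0"
    using pos_def_hermitian_corner[OF pd] by auto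
  show "?Y \<in> carrier_mat n n" by (simp add: schur_complement_def)
  show "mat_adjoint ?Y = ?Y"
    by (rule eq_matI)
      (auto simp: schur_complement_def mat_adjoint_eq simp flip: pos_def_hermitian_index[OF pd])
  fix v :: "complex vec" assume v: "v \<in> carrier_vec n" "v \<noteq> 0\<^sub>v n"
  define s where "s = (\<Sum>j\<in>{0..<n}. X $$ (0, Suc j) * v $ j)"
  define w where "w = vCons (- s / X $$ (0, 0)) v"
  have w: "w \<in> carrier_vec (Suc n)" "w \<noteq> 0\<^sub>v (Suc n)"
    using v by (auto simp: w_def zero_vec_Suc)
  have Xw: "(X *\<^sub>v w) $ i = X $$ (i, 0) * (- s / X $$ (0, 0)) + (\<Sum>j\<in>{0..<n}. X $$ (i, Suc j) * v $ j)"
    if "i < Suc n" for i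
    using that X v
    by (auto simp: w_def scalar_prod_def sum.atLeast0_lessThan_Suc_shift simp del: sum.op_ivl_Suc)
  have "X *\<^sub>v w = vCons 0 (?Y *\<^sub>v v)"
  proof (rule eq_vecI)
    fix i assume "i < dim_vec (vCons 0 (?Y *\<^sub>v v))"
    then have i: "i < Suc n" by (simp add: schur_complement_def)
    show "(X *\<^sub>v w) $ i = vCons 0 (?Y *\<^sub>v v) $ i"
    proof (cases i)
      case 0
      then show ?thesis using Xw[of 0] a0 by (simp add: s_def)
    next
      case (Suc k)
      have "X $$ (Suc k, 0) * (- s / X $$ (0, 0)) =
          (\<Sum>j\<in>{0..<n}. - (X $$ (Suc k, 0) * X $$ (0, Suc j) / X $$ (0, 0)) * v $ j)"
        by (simp add: s_def sum_distrib_left sum_divide_distrib sum_negf mult_ac)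
      moreover have "(?Y *\<^sub>v v) $ k = (\<Sum>j\<in>{0..<n}. 
          (X $$ (Suc k, Suc j) - X $$ (Suc k, 0) * X $$ (0, Suc j) / X $$ (0, 0)) * v $ j)"
        using i Suc v by (auto simp: schur_complement_def scalar_prod_def)
      ultimately show ?thesis
        using Xw[OF i] Suc by (simp add: left_diff_distrib sum_subtractf sum_negf)
    qed
  qed (use X in \<open>simp add: schur_complement_def\<close>)
  then have "(X *\<^sub>v w) \<bullet>c w = (?Y *\<^sub>v v) \<bullet>c v"
    by (simp add: w_def)
  then show "Re ((?Y *\<^sub>v v) \<bullet>c v) > 0"
    using pd w unfolding pos_def_hermitian_def by metis
qed

text \<open>
  Induction on the size: the first row of \<open>P\<close> is the first row of \<open>X\<close> divided by
  $\sqrt{X_{00}}$, and the remaining block of \<open>P\<close> factorises the Schur complement, which is what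
  is left of \<open>X\<close> after subtracting the rank one contribution of that row.
\<close>

lemma cholesky:
  "pos_def_hermitian n X \<Longrightarrow> \<exists>P \<in> carrier_mat n n. X = mat_adjoint P * P"
proof (induction n arbitrary: X)
  case 0
  then have "X = mat_adjoint (1\<^sub>m 0) * 1\<^sub>m 0"
    by (intro eq_matI) (auto simp: pos_def_hermitian_def mat_adjoint_eq)
  then show ?case by (intro bexI[of _ "1\<^sub>m 0"]) auto
next
  case (Suc n)
  note herm = pos_def_hermitian_index[OF Suc.prems]
  have X: "X \<in> carrier_mat (Suc n) (Suc n)" using Suc.prems by (simp add: pos_def_hermitian_def)
  obtain Q where Q: "Q \<in> carrier_mat n n" and YQ: "schur_complement X n = mat_adjoint Q * Q"
    using Suc.IH[OF pos_def_hermitian_schur_complement[OF Suc.prems]] by blast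
  define r where "r = complex_of_real (sqrt (Re (X $$ (0, 0))))"
  have r: "r * r = X $$ (0, 0)" "cnj r = r" "r \<noteq> 0"
    using pos_def_hermitian_corner[OF Suc.prems]
    by (auto simp: r_def complex_eq_iff simp flip: of_real_mult)
  define P where "P = mat (Suc n) (Suc n) (\<lambda>(i, j).
    case i of 0 \<Rightarrow> X $$ (0, j) / r | Suc k \<Rightarrow> (case j of 0 \<Rightarrow> 0 | Suc l \<Rightarrow> Q $$ (k, l)))"
  have PP: "(mat_adjoint P * P) $$ (i, j) = cnj (X $$ (0, i) / r) * (X $$ (0, j) / r) +
     (\<Sum>k\<in>{0..<n}. cnj (P $$ (Suc k, i)) * P $$ (Suc k, j))" if "i < Suc n" "j < Suc n" for i j
    using that by (auto simp: P_def mat_adjoint_eq scalar_prod_def sum.atLeast0_lessThan_Suc_shift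
        simp del: sum.op_ivl_Suc)
  have QQ: "X $$ (Suc i, Suc j) - X $$ (Suc i, 0) * X $$ (0, Suc j) / X $$ (0, 0) =
      (\<Sum>k\<in>{0..<n}. cnj (Q $$ (k, i)) * Q $$ (k, j))" if "i < n" "j < n" for i j
    using that Q arg_cong[OF YQ, of "\<lambda>A. A $$ (i, j)"]
    by (auto simp: schur_complement_def mat_adjoint_eq scalar_prod_def)
  have "X = mat_adjoint P * P"
  proof (rule eq_matI)
    fix i j assume "i < dim_row (mat_adjoint P * P)" "j < dim_col (mat_adjoint P * P)"
    then have ij: "i < Suc n" "j < Suc n" by (auto simp: P_def mat_adjoint_eq)
    have "cnj (X $$ (0, i) / r) * (X $$ (0, j) / r) = X $$ (i, 0) * X $$ (0, j) / X $$ (0, 0)"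
      using herm[of i 0] ij r by (simp add: mult_ac)
    moreover have "(\<Sum>k\<in>{0..<n}. cnj (P $$ (Suc k, i)) * P $$ (Suc k, j)) =
        X $$ (i, j) - X $$ (i, 0) * X $$ (0, j) / X $$ (0, 0)"
      using ij r by (cases i; cases j) (auto simp: P_def QQ)
    ultimately show "X $$ (i, j) = (mat_adjoint P * P) $$ (i, j)"
      using PP[OF ij] by simp
  qed (use X in \<open>auto simp: P_def mat_adjoint_eq\<close>)
  then show ?case by (intro bexI[of _ P]) (auto simp: P_def)
qed

lemma pos_def_hermitian_det:
  assumes "pos_def_hermitian n X"
  shows "det X \<noteq> 0"
proof
  assume "det X = 0"
  moreover have "X \<in> carrier_mat n n" using assms by (simp add: pos_def_hermitian_def)
  ultimately obtain v where v: "v \<in> carrier_vec n" "v \<noteq> 0\<^sub>v n" "X *\<^sub>v v = 0\<^sub>v n"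
    using det_0_iff_vec_prod_zero by blast
  then have "(X *\<^sub>v v) \<bullet>c v = 0" by (simp add: scalar_prod_left_zero)
  moreover have "Re ((X *\<^sub>v v) \<bullet>c v) > 0"
    using v assms unfolding pos_def_hermitian_def by blast
  ultimately show False by simp
qed

lemma pos_def_hermitian_iff_gram:
  "pos_def_hermitian n X \<longleftrightarrow> (\<exists>P \<in> carrier_mat n n. det P \<noteq> 0 \<and> X = mat_adjoint P * P)"
proof
  assume pd: "pos_def_hermitian n X"
  then obtain P where P: "P \<in> carrier_mat n n" "X = mat_adjoint P * P"
    using cholesky by blast
  then have "det X = det (mat_adjoint P) * det P"
    by (simp add: det_mult[of _ n])
  then have "det P \<noteq> 0" using pos_def_hermitian_det[OF pd] by auto
  then show "\<exists>P \<in> carrier_mat n n. det P \<noteq> 0 \<and> X = mat_adjoint P * P" using P by blast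
qed (use pos_def_hermitian_gram in blast)

text \<open>
  For an eigenvector \<open>v\<close>, $e \|v\|^2 = \|Av\|^2$.
\<close>

lemma char_poly_gram_root_real:
  assumes A: "A \<in> carrier_mat n n" and root: "poly (char_poly (mat_adjoint A * A)) e = 0"
  shows "Im e = 0"
proof -
  have G: "mat_adjoint A * A \<in> carrier_mat n n" using A by simp
  obtain v where v: "v \<in> carrier_vec n" "v \<noteq> 0\<^sub>v n" "(mat_adjoint A * A) *\<^sub>v v = e \<cdot>\<^sub>v v"
    using root G by (auto simp: eigenvalue_root_char_poly[OF G, symmetric] eigenvalue_def eigenvector_def)
  have "e * (v \<bullet>c v) = ((mat_adjoint A * A) *\<^sub>v v) \<bullet>c v"
    using v by simp
  also have "\<dots> = (A *\<^sub>v v) \<bullet>c (A *\<^sub>v v)"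
    using A v(1) by (subst assoc_mult_mat_vec[of _ n n _ n]) (auto simp: cscalar_prod_adjoint[of _ n n])
  finally have "Im (e * (v \<bullet>c v)) = 0"
    using conjugate_square_ge_0_vec[of "A *\<^sub>v v"] by (simp add: less_eq_complex_def)
  then show ?thesis
    using cscalar_prod_self[OF v(1,2)] by simp
qed

section \<open>Pencils of Gram matrices\<close>

lemma det_pencil_index:
  assumes "X \<in> carrier_mat n n" "Y \<in> carrier_mat n n" "Z \<in> carrier_mat n n"
  shows "det_pencil X Y Z = det (mat n n (\<lambda>(i, j).
    var_x * const3 (X $$ (i, j)) + var_y * const3 (Y $$ (i, j)) + var_z * const3 (Z $$ (i, j))))"
  unfolding det_pencil_def
  by (rule arg_cong[of _ _ det], rule eq_matI) (use assms in auto)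

lemma homogeneous3_det_pencil:
  assumes "X \<in> carrier_mat n n" "Y \<in> carrier_mat n n" "Z \<in> carrier_mat n n"
  shows "homogeneous3 n (det_pencil X Y Z)"
proof -
  have lin: "homogeneous3 1 (v * const3 c)" if "homogeneous3 1 v" for v :: "complex poly3" and c
    using homogeneous3_mult[OF that homogeneous3_const3] by simp
  have "homogeneous3 (0 + n) (signof p * (\<Prod>i = 0..<n. var_x * const3 (X $$ (i, p i)) +
      var_y * const3 (Y $$ (i, p i)) + var_z * const3 (Z $$ (i, p i))))" (is "homogeneous3 _ (_ * ?P)")
    if "p permutes {0..<n}" for p
  proof (rule homogeneous3_mult)
    show "homogeneous3 0 (signof p :: complex poly3)"
      by (simp add: sign_def homogeneous3_def zero_prod_def)
    have "homogeneous3 (card {0..<n}) ?P"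
      by (rule homogeneous3_prod) (intro homogeneous3_add lin homogeneous3_var, simp)
    then show "homogeneous3 n ?P" by simp
  qed
  moreover have "(\<Prod>i = 0..<n. mat n n f $$ (i, p i)) = (\<Prod>i = 0..<n. f (i, p i))"
    if "p permutes {0..<n}" for p and f :: "nat \<times> nat \<Rightarrow> complex poly3"
    using permutes_in_image[OF that] by (intro prod.cong) auto
  ultimately show ?thesis
    unfolding det_pencil_index[OF assms]
    by (subst det_def'[of _ n]) (auto intro!: homogeneous3_sum)
qed

text \<open>
  Conjugating the entries of a Hermitian matrix transposes it, and the determinant does not see the
  transposition.
\<close>

lemma map_cnj_det_pencil:
  assumes X: "X \<in> carrier_mat n n" "mat_adjoint X = X"
    and Y: "Y \<in> carrier_mat n n" "mat_adjoint Y = Y"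
    and Z: "Z \<in> carrier_mat n n" "mat_adjoint Z = Z"
  shows "Poly_Mapping.map cnj (det_pencil X Y Z) = det_pencil X Y Z"
proof -
  interpret cnj: comm_ring_hom "Poly_Mapping.map cnj :: complex poly3 \<Rightarrow> complex poly3"
    by (rule map_cnj_hom)
  let ?f = "\<lambda>i j. var_x * const3 (X $$ (i, j)) + var_y * const3 (Y $$ (i, j)) + var_z * const3 (Z $$ (i, j))"
  have cnj_index: "cnj (W $$ (i, j)) = W $$ (j, i)"
    if "W \<in> carrier_mat n n" "mat_adjoint W = W" "i < n" "j < n" for W :: "complex mat" and i j
    using mat_adjoint_index[of j W i] that by simp
  have "Poly_Mapping.map cnj (?f i j) = ?f j i" if "i < n" "j < n" for i j
    using that assms
    by (simp add: cnj.hom_add cnj.hom_mult cnj_index const3_def var_x_def var_y_def var_z_def)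
  then have "map_mat (Poly_Mapping.map cnj) (mat n n (\<lambda>(i, j). ?f i j)) =
      transpose_mat (mat n n (\<lambda>(i, j). ?f i j))"
    by (intro eq_matI) auto
  then show ?thesis
    unfolding det_pencil_index[OF X(1) Y(1) Z(1)]
    by (simp add: det_transpose[of _ n] flip: cnj.hom_det)
qed

lemma real_det_pencil:
  assumes "pos_def_hermitian n X" "pos_def_hermitian n Y" "pos_def_hermitian n Z"
  obtains F where "F \<in> vinnikov_polys n" "Poly_Mapping.map complex_of_real F = det_pencil X Y Z"
proof -
  note pd = assms[unfolded pos_def_hermitian_def]
  define F where "F = Poly_Mapping.map Re (det_pencil X Y Z)"
  have F: "Poly_Mapping.map complex_of_real F = det_pencil X Y Z"
  proof (rule poly_mapping_eqI)
    fix k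
    have "cnj (Poly_Mapping.lookup (det_pencil X Y Z) k) = Poly_Mapping.lookup (det_pencil X Y Z) k"
      using map_cnj_det_pencil[of X n Y Z] pd lookup_map_hom[of cnj "det_pencil X Y Z" k] by simp
    then have "Poly_Mapping.lookup (det_pencil X Y Z) k \<in> \<real>"
      by (simp add: Reals_cnj_iff)
    then show "Poly_Mapping.lookup (Poly_Mapping.map complex_of_real F) k =
        Poly_Mapping.lookup (det_pencil X Y Z) k"
      by (simp add: F_def lookup_map_hom of_real_Re)
  qed
  moreover have "Poly_Mapping.keys F = Poly_Mapping.keys (det_pencil X Y Z)"
    unfolding F[symmetric] by (auto simp: in_keys_iff lookup_map_hom)
  then have "homogeneous3 n F"
    using homogeneous3_det_pencil[of X n Y Z] pd by (simp add: homogeneous3_def)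
  ultimately show thesis
    using assms by (intro that[of F]) (auto simp: vinnikov_polys_def)
qed

lemma subst3_det_pencil:
  assumes "X \<in> carrier_mat n n" "Y \<in> carrier_mat n n" "Z \<in> carrier_mat n n"
  shows "subst3 (det_pencil X Y Z) p q r = det (mat n n (\<lambda>(i, j).
    Polynomial.smult (X $$ (i, j)) p + Polynomial.smult (Y $$ (i, j)) q +
    Polynomial.smult (Z $$ (i, j)) r))"
proof -
  interpret subst: comm_ring_hom "\<lambda>F::complex poly3. subst3 F p q r"
    by (rule subst3_hom)
  show ?thesis
    unfolding det_pencil_index[OF assms] subst.hom_det[symmetric]
    by (rule arg_cong[of _ _ det], rule eq_matI)
      (auto simp: subst3_add subst3_mult subst3_const3 subst3_var)
qed

text \<open>
  The matrix $u Q^*Q - P^*P$ is congruent to the characteristic matrix of $A^*A$: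
  since $P = AQ$, it equals $Q^* (u - A^*A) Q$.
\<close>

lemma det_gram_pencil:
  fixes A :: "complex mat"
  assumes A: "A \<in> carrier_mat n n" and Q: "Q \<in> carrier_mat n n" and P: "P = A * Q"
  shows "det (mat n n (\<lambda>(i, j). Polynomial.smult ((mat_adjoint Q * Q) $$ (i, j)) [:0, 1:]
      - [:(mat_adjoint P * P) $$ (i, j):])) =
    Polynomial.smult (det (mat_adjoint Q * Q)) (char_poly (mat_adjoint A * A))"
    (is "det ?M = _")
proof -
  interpret c: comm_ring_hom "\<lambda>a::complex. [:a:]"
    by unfold_locales auto
  let ?c = "map_mat (\<lambda>a::complex. [:a:])"
  let ?u = "[:0, 1:] :: complex poly"
  define G where "G = mat_adjoint A * A"
  have G: "G \<in> carrier_mat n n" using A by (simp add: G_def)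
  have Q': "mat_adjoint Q \<in> carrier_mat n n" using Q by simp
  have pencil: "?u \<cdot>\<^sub>m ?c M - ?c N = mat n n (\<lambda>(i, j). Polynomial.smult (M $$ (i, j)) ?u - [:N $$ (i, j):])"
    if "M \<in> carrier_mat n n" "N \<in> carrier_mat n n" for M N
    using that by (intro eq_matI) auto
  have PC: "P \<in> carrier_mat n n" using A Q by (simp add: P)
  have PP: "mat_adjoint P * P = mat_adjoint Q * (G * Q)"
    unfolding P G_def using A Q
    by (simp add: mat_adjoint_mult[OF A Q] assoc_mult_mat[of _ n n _ n _ n])
  have char: "char_poly_matrix G = ?u \<cdot>\<^sub>m 1\<^sub>m n - ?c G"
    using G by (intro eq_matI) (auto simp: char_poly_matrix_def)
  have "?c (mat_adjoint Q) * char_poly_matrix G * ?c Q =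
      ?c (mat_adjoint Q) * (?u \<cdot>\<^sub>m ?c Q - ?c G * ?c Q)"
    using Q Q' G minus_mult_distrib_mat[of "?u \<cdot>\<^sub>m 1\<^sub>m n" n n "?c G" "?c Q" n]
    by (subst assoc_mult_mat[of _ n n _ n _ n])
      (auto simp: char mult_smult_assoc_mat[of _ n n _ n])
  also have "\<dots> = ?u \<cdot>\<^sub>m (?c (mat_adjoint Q) * ?c Q) - ?c (mat_adjoint Q) * (?c G * ?c Q)"
    using Q Q' G
    by (simp add: mult_minus_distrib_mat[of _ n n _ n] mult_smult_distrib[of _ n n _ n])
  also have "\<dots> = ?u \<cdot>\<^sub>m ?c (mat_adjoint Q * Q) - ?c (mat_adjoint P * P)"
    unfolding PP using Q Q' G
    by (simp add: c.mat_hom_mult[of _ n n _ n])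
  also have "\<dots> = ?M"
    by (rule pencil) (use Q PC in simp_all)
  finally have "det ?M = det (?c (mat_adjoint Q) * char_poly_matrix G * ?c Q)" by simp
  also have "\<dots> = det (?c (mat_adjoint Q) * char_poly_matrix G) * det (?c Q)"
    by (rule det_mult[of _ n]) (use Q Q' G in \<open>auto intro!: mult_carrier_mat[of _ n n]\<close>)
  also have "det (?c (mat_adjoint Q) * char_poly_matrix G) =
      det (?c (mat_adjoint Q)) * det (char_poly_matrix G)"
    by (rule det_mult[of _ n]) (use Q' G in auto)
  also have "det (?c (mat_adjoint Q)) * det (char_poly_matrix G) * det (?c Q) =
      [:det (mat_adjoint Q) * det Q:] * char_poly G"
    by (simp add: c.hom_det char_poly_def mult.commute)
  also have "det (mat_adjoint Q) * det Q = det (mat_adjoint Q * Q)"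
    using Q Q' by (simp add: det_mult[of _ n])
  also have "[:det (mat_adjoint Q * Q):] * char_poly G =
      Polynomial.smult (det (mat_adjoint Q * Q)) (char_poly (mat_adjoint A * A))"
    by (simp add: G_def)
  finally show ?thesis .
qed


section \<open>Real zeros and singular values\<close>

lemma proots_prod_linear: "proots (\<Prod>x\<in>#M. [:- x, 1:]) = M" for M :: "'a::idom multiset"
proof (induction M)
  case (add x M)
  have "(\<Prod>x\<in>#M. [:- x, 1:]) \<noteq> 0"
    by (auto simp: prod_mset_zero_iff)
  then have "proots ([:- x, 1:] * (\<Prod>x\<in>#M. [:- x, 1:])) = {#x#} + M"
    using add.IH proots_linear_factor[of "- x"] by (subst proots_mult) auto
  then show ?case by simp
qed simp

text \<open>
  The zeros of a real polynomial are found inside the complex numbers: the characteristic polynomial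
  splits there, its roots are real, and hence the factorisation descends to the reals.
\<close>

lemma sqrt_zeros_eq_singular_values:
  assumes A: "A \<in> carrier_mat n n" and c: "c \<noteq> 0"
    and p: "map_poly complex_of_real p = Polynomial.smult c (char_poly (mat_adjoint A * A))"
  shows "sqrt_zeros p = singular_values A" "degree p = n" "p \<noteq> 0"
proof -
  interpret inj: map_poly_inj_idom_hom complex_of_real
    by unfold_locales auto
  define G where "G = mat_adjoint A * A"
  define M where "M = image_mset Re (proots (char_poly G))"
  have G: "degree (char_poly G) = n" "lead_coeff (char_poly G) = 1"
    using degree_monic_char_poly[of G n] A by (auto simp: G_def)
  then have G0: "char_poly G \<noteq> 0" by auto
  have "degree (map_poly complex_of_real p) = n"
    unfolding p G_def[symmetric] using G c by simp
  then show "degree p = n" by simp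
  show p0: "p \<noteq> 0"
  proof
    assume "p = 0"
    then have "Polynomial.smult c (char_poly G) = 0" using p by (simp add: G_def)
    then show False using c G0 by simp
  qed
  have "lead_coeff (map_poly complex_of_real p) = c"
    unfolding p G_def[symmetric] using G by (simp add: lead_coeff_smult)
  then have c_real: "c = complex_of_real (lead_coeff p)" by simp
  have roots: "complex_of_real (Re e) = e" if "e \<in># proots (char_poly G)" for e
    using that char_poly_gram_root_real[OF A, of e] G0 by (auto simp: G_def complex_eq_iff)
  have "map_poly complex_of_real (\<Prod>x\<in>#M. [:- x, 1:]) = (\<Prod>x\<in>#M. [:- complex_of_real x, 1:])"
    by (induction M) (simp_all add: inj.hom_mult del: mult_pCons_left)
  also have "\<dots> = (\<Prod>x\<in>#proots (char_poly G). [:- x, 1:])"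
    unfolding M_def using roots by (simp add: image_mset.compositionality o_def cong: image_mset_cong)
  also have "\<dots> = char_poly G"
    using complex_poly_decompose_multiset[of "char_poly G"] G by simp
  finally have "map_poly complex_of_real p =
      map_poly complex_of_real (Polynomial.smult (lead_coeff p) (\<Prod>x\<in>#M. [:- x, 1:]))"
    using p c_real by (simp add: of_real_hom.map_poly_hom_smult G_def)
  then have "p = Polynomial.smult (lead_coeff p) (\<Prod>x\<in>#M. [:- x, 1:])"
    by (rule inj.injectivity)
  then have "proots p = M"
    using p0 proots_smult[of "lead_coeff p" "\<Prod>x\<in>#M. [:- x, 1:]"] by (simp add: proots_prod_linear)
  then show "sqrt_zeros p = singular_values A"
    by (simp add: sqrt_zeros_def singular_values_def M_def G_def image_mset.compositionality o_def)
qed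

lemma pencil_edge:
  assumes A: "A \<in> carrier_mat n n" and Q: "Q \<in> carrier_mat n n" "det Q \<noteq> 0" and P: "P = A * Q"
    and p: "map_poly complex_of_real p = det (mat n n (\<lambda>(i, j).
      Polynomial.smult ((mat_adjoint Q * Q) $$ (i, j)) [:0, 1:] - [:(mat_adjoint P * P) $$ (i, j):]))"
  shows "sqrt_zeros p = singular_values A \<and> degree p = n \<and> p \<noteq> 0"
proof -
  have "det (mat_adjoint Q * Q) \<noteq> 0"
    using Q by (simp add: det_mult[of _ n] det_mat_adjoint)
  then show ?thesis
    using sqrt_zeros_eq_singular_values[OF A] det_gram_pencil[OF A Q(1) P] p by metis
qed

text \<open>
  This nondegeneracy of the restrictions to the three coordinate lines is what permits counting
  zeros there.
\<close>

definition edges_nondegenerate :: "nat \<Rightarrow> real poly3 \<Rightarrow> bool" where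
  "edges_nondegenerate n F \<longleftrightarrow>
    (\<forall>p \<in> {subst3 F (-1) [:0, 1:] 0, subst3 F 0 (-1) [:0, 1:], subst3 F [:0, 1:] 0 (-1)}.
      p \<noteq> 0 \<and> degree p = n)"

text \<open>
  The three relations are cyclic, so one computation serves all three coordinate lines. They imply
  $ABC = 1$, because $P = AQ = ABR = ABCP$; assuming them instead of $ABC = 1$ avoids inverses.
\<close>

lemma boundary_gram_pencil:
  assumes carrier: "A \<in> carrier_mat n n" "B \<in> carrier_mat n n" "C \<in> carrier_mat n n"
      "P \<in> carrier_mat n n" "Q \<in> carrier_mat n n" "R \<in> carrier_mat n n"
    and det: "det P \<noteq> 0" "det Q \<noteq> 0" "det R \<noteq> 0"
    and ratio: "P = A * Q" "Q = B * R" "R = C * P"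
    and F: "Poly_Mapping.map complex_of_real F =
      det_pencil (mat_adjoint P * P) (mat_adjoint Q * Q) (mat_adjoint R * R)"
  shows "boundary F = (singular_values A, singular_values B, singular_values C)"
    and "edges_nondegenerate n F"
proof -
  let ?u = "[:0, 1:] :: real poly"
  note gram = gram_carrier[OF carrier(4)] gram_carrier[OF carrier(5)] gram_carrier[OF carrier(6)]
  have subst: "map_poly complex_of_real (subst3 F p q r) = det (mat n n (\<lambda>(i, j).
      Polynomial.smult ((mat_adjoint P * P) $$ (i, j)) (map_poly complex_of_real p) +
      Polynomial.smult ((mat_adjoint Q * Q) $$ (i, j)) (map_poly complex_of_real q) +
      Polynomial.smult ((mat_adjoint R * R) $$ (i, j)) (map_poly complex_of_real r)))" for p q r
    unfolding subst3_map_of_real[symmetric] F subst3_det_pencil[OF gram] ..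
  have eval: "map_poly complex_of_real (-1) = -1" "map_poly complex_of_real [:0, 1:] = [:0, 1:]"
    by (simp_all add: one_pCons)
  have edge1: "sqrt_zeros (subst3 F (-1) ?u 0) = singular_values A \<and>
      degree (subst3 F (-1) ?u 0) = n \<and> subst3 F (-1) ?u 0 \<noteq> 0"
    by (rule pencil_edge[OF carrier(1,5) det(2) ratio(1)])
      (simp add: subst eval one_pCons cong: cong_mat)
  have edge2: "sqrt_zeros (subst3 F 0 (-1) ?u) = singular_values B \<and>
      degree (subst3 F 0 (-1) ?u) = n \<and> subst3 F 0 (-1) ?u \<noteq> 0"
    by (rule pencil_edge[OF carrier(2,6) det(3) ratio(2)])
      (simp add: subst eval one_pCons cong: cong_mat)
  have edge3: "sqrt_zeros (subst3 F ?u 0 (-1)) = singular_values C \<and>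
      degree (subst3 F ?u 0 (-1)) = n \<and> subst3 F ?u 0 (-1) \<noteq> 0"
    by (rule pencil_edge[OF carrier(3,4) det(1) ratio(3)])
      (simp add: subst eval one_pCons cong: cong_mat)
  show "boundary F = (singular_values A, singular_values B, singular_values C)"
    using edge1 edge2 edge3 by (simp add: boundary_def Let_def)
  show "edges_nondegenerate n F"
    using edge1 edge2 edge3 by (simp add: edges_nondegenerate_def)
qed

lemma inverse_matE:
  fixes A :: "'a::field mat"
  assumes "A \<in> carrier_mat n n" "det A \<noteq> 0"
  obtains B where "B \<in> carrier_mat n n" "A * B = 1\<^sub>m n" "B * A = 1\<^sub>m n"
  using det_non_zero_imp_unit[OF assms, of "()"] by (auto simp: Units_def ring_mat_def)

lemma det_nonzero_if_mult_one:
  fixes A :: "'a::field mat"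
  assumes "A \<in> carrier_mat n n" "B \<in> carrier_mat n n" "C \<in> carrier_mat n n"
    and "A * B * C = 1\<^sub>m n"
  shows "det A \<noteq> 0" "det B \<noteq> 0" "det C \<noteq> 0"
proof -
  have AB: "A * B \<in> carrier_mat n n" using assms by simp
  have "det A * det B * det C = det (A * B * C)"
    by (simp only: det_mult[OF AB assms(3)] det_mult[OF assms(1,2)])
  then show "det A \<noteq> 0" "det B \<noteq> 0" "det C \<noteq> 0"
    using assms(4) by auto
qed

text \<open>
  With $R = 1$, $Q = B$ and $P = AB$ the required relation $R = CP$ is $CAB = 1$, a cyclic
  rearrangement of $ABC = 1$.
\<close>

lemma vinnikov_polys_from_matrices:
  assumes carrier: "A \<in> carrier_mat n n" "B \<in> carrier_mat n n" "C \<in> carrier_mat n n"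
    and ABC: "A * B * C = 1\<^sub>m n"
  obtains F where "F \<in> vinnikov_polys n"
    "boundary F = (singular_values A, singular_values B, singular_values C)"
proof -
  note det = det_nonzero_if_mult_one[OF carrier ABC]
  have P: "A * B \<in> carrier_mat n n" "det (A * B) \<noteq> 0"
    using carrier det by (simp_all add: det_mult[of _ n])
  have I: "1\<^sub>m n \<in> carrier_mat n n" "det (1\<^sub>m n :: complex mat) \<noteq> 0" by simp_all
  obtain F where F: "F \<in> vinnikov_polys n" "Poly_Mapping.map complex_of_real F = det_pencil
      (mat_adjoint (A * B) * (A * B)) (mat_adjoint B * B) (mat_adjoint (1\<^sub>m n) * 1\<^sub>m n)"
    by (rule real_det_pencil[OF pos_def_hermitian_gram[OF P]
          pos_def_hermitian_gram[OF carrier(2) det(2)] pos_def_hermitian_gram[OF I]])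
  have "1\<^sub>m n = C * (A * B)"
    using mat_mult_left_right_inverse[OF P(1) carrier(3) ABC] ..
  moreover have "B = B * 1\<^sub>m n" using carrier by simp
  ultimately have "boundary F = (singular_values A, singular_values B, singular_values C)"
    by (intro boundary_gram_pencil(1)
        [OF carrier P(1) carrier(2) I(1) P(2) det(2) I(2) refl _ _ F(2)])
  with F(1) show thesis by (rule that)
qed

lemma vinnikov_polys_to_matrices:
  assumes "F \<in> vinnikov_polys n"
  obtains A B C where "A \<in> carrier_mat n n" "B \<in> carrier_mat n n" "C \<in> carrier_mat n n"
    "A * B * C = 1\<^sub>m n"
    "boundary F = (singular_values A, singular_values B, singular_values C)"
    "edges_nondegenerate n F"
proof -
  obtain P Q R where P: "P \<in> carrier_mat n n" "det P \<noteq> 0" and Q: "Q \<in> carrier_mat n n" "det Q \<noteq> 0"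
    and R: "R \<in> carrier_mat n n" "det R \<noteq> 0"
    and F: "Poly_Mapping.map complex_of_real F =
      det_pencil (mat_adjoint P * P) (mat_adjoint Q * Q) (mat_adjoint R * R)"
    using assms by (auto simp: vinnikov_polys_def pos_def_hermitian_iff_gram)
  obtain P' where P': "P' \<in> carrier_mat n n" "P * P' = 1\<^sub>m n" "P' * P = 1\<^sub>m n"
    using inverse_matE[OF P] .
  obtain Q' where Q': "Q' \<in> carrier_mat n n" "Q * Q' = 1\<^sub>m n" "Q' * Q = 1\<^sub>m n"
    using inverse_matE[OF Q] .
  obtain R' where R': "R' \<in> carrier_mat n n" "R * R' = 1\<^sub>m n" "R' * R = 1\<^sub>m n"
    using inverse_matE[OF R] .
  have cancel: "S * T' * T = S" if "S \<in> carrier_mat n n" "T \<in> carrier_mat n n" "T' \<in> carrier_mat n n"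
    "T' * T = 1\<^sub>m n" for S T T' :: "complex mat"
    using that by (simp add: assoc_mult_mat[of _ n n _ n _ n])
  have carrier: "P * Q' \<in> carrier_mat n n" "Q * R' \<in> carrier_mat n n" "R * P' \<in> carrier_mat n n"
    using P Q R P' Q' R' by simp_all
  have ratio: "P = P * Q' * Q" "Q = Q * R' * R" "R = R * P' * P"
    using P Q R P' Q' R' by (simp_all add: cancel)
  have "P * Q' * (Q * R') = P * Q' * Q * R'"
    by (rule assoc_mult_mat[symmetric, of _ n n _ n _ n]) (use carrier Q R' in simp_all)
  then have PR: "P * Q' * (Q * R') = P * R'"
    by (simp only: ratio(1)[symmetric])
  have "P * R' * (R * P') = P * R' * R * P'"
    by (rule assoc_mult_mat[symmetric, of _ n n _ n _ n]) (use P R P' R' in simp_all)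
  then have "P * Q' * (Q * R') * (R * P') = 1\<^sub>m n"
    by (simp only: PR cancel[OF P(1) R(1) R'(1,3)] P'(2))
  then show thesis
    using that carrier boundary_gram_pencil[OF carrier P(1) Q(1) R(1) P(2) Q(2) R(2) ratio F] by blast
qed

lemma invertible_mat_if_det:
  fixes A :: "'a::field mat"
  assumes "A \<in> carrier_mat n n" "det A \<noteq> 0"
  shows "invertible_mat A"
  using inverse_matE[OF assms] assms(1)
  by (metis carrier_matD invertible_mat_def inverts_mat_def square_mat.simps)

lemma horn_iff_boundary:
  "horn_multiplicative_solvable n \<alpha> \<beta> \<gamma> \<longleftrightarrow> (\<exists>F \<in> vinnikov_polys n. boundary F = (\<alpha>, \<beta>, \<gamma>))"
proof
  assume "horn_multiplicative_solvable n \<alpha> \<beta> \<gamma>"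
  then obtain A B C where ABC: "A \<in> carrier_mat n n" "B \<in> carrier_mat n n"
      "C \<in> carrier_mat n n" "A * B * C = 1\<^sub>m n"
    and sv: "singular_values A = \<alpha>" "singular_values B = \<beta>" "singular_values C = \<gamma>"
    unfolding horn_multiplicative_solvable_def by blast
  obtain F where "F \<in> vinnikov_polys n"
    "boundary F = (singular_values A, singular_values B, singular_values C)"
    by (rule vinnikov_polys_from_matrices[OF ABC])
  then show "\<exists>F \<in> vinnikov_polys n. boundary F = (\<alpha>, \<beta>, \<gamma>)"
    unfolding sv by blast
next
  assume "\<exists>F \<in> vinnikov_polys n. boundary F = (\<alpha>, \<beta>, \<gamma>)"
  then obtain F where F: "F \<in> vinnikov_polys n" "boundary F = (\<alpha>, \<beta>, \<gamma>)" by blast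
  obtain A B C where carrier: "A \<in> carrier_mat n n" "B \<in> carrier_mat n n" "C \<in> carrier_mat n n"
    and ABC: "A * B * C = 1\<^sub>m n"
    and boundary: "boundary F = (singular_values A, singular_values B, singular_values C)"
    by (rule vinnikov_polys_to_matrices[OF F(1)])
  have "invertible_mat A" "invertible_mat B" "invertible_mat C"
    using carrier det_nonzero_if_mult_one[OF carrier ABC] invertible_mat_if_det by blast+
  then show "horn_multiplicative_solvable n \<alpha> \<beta> \<gamma>"
    unfolding horn_multiplicative_solvable_def using carrier ABC boundary F(2)
    by (intro exI[of _ A] exI[of _ B] exI[of _ C]) simp
qed


section \<open>Intersection multiplicities with the coordinate lines\<close>

lemma decreasing_list_of_mset:
  "sorted_wrt (\<ge>) xs \<Longrightarrow> decreasing_list_of (mset xs) = xs"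
proof -
  assume "sorted_wrt (\<ge>) xs"
  then have "sorted (rev xs)" by (simp add: sorted_wrt_rev)
  then have "sort xs = rev xs"
    by (metis mset_rev properties_for_sort)
  then show ?thesis by (simp add: decreasing_list_of_def)
qed

lemma mset_decreasing_list_of [simp]: "mset (decreasing_list_of M) = M"
  by (simp add: decreasing_list_of_def)

lemma count_image_mset_inj: "inj f \<Longrightarrow> count (image_mset f M) (f x) = count M x"
  by (induction M) (auto simp: inj_eq)

text \<open>
  The order conditions say that the listed roots form a submultiset of the square roots of all zeros.
  As there are at most \<open>n\<close> zeros and \<open>n\<close> entries in the list, the two multisets agree.
\<close>

lemma sqrt_zeros_eq_iff_order:
  assumes \<alpha>: "decreasing_pos_tuple n \<alpha>" and p: "p \<noteq> 0" "degree p = n"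
  shows "sqrt_zeros p = \<alpha> \<longleftrightarrow> (\<forall>a \<in> set \<alpha>. Polynomial.order (a\<^sup>2) p = count (mset \<alpha>) a)"
proof -
  define N where "N = image_mset sqrt (proots p)"
  have order: "Polynomial.order (a\<^sup>2) p = count N a" if "a \<in> set \<alpha>" for a
  proof -
    have "inj sqrt" by (simp add: inj_def)
    moreover have "sqrt (a\<^sup>2) = a" using \<alpha> that by (auto simp: decreasing_pos_tuple_def)
    ultimately have "count N a = count (proots p) (a\<^sup>2)"
      unfolding N_def by (metis count_image_mset_inj)
    then show ?thesis using p by simp
  qed
  have "sqrt_zeros p = \<alpha> \<longleftrightarrow> N = mset \<alpha>"
    using \<alpha> decreasing_list_of_mset[of \<alpha>] mset_decreasing_list_of[of N]
    by (metis N_def decreasing_pos_tuple_def sqrt_zeros_def)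
  also have "\<dots> \<longleftrightarrow> (\<forall>a \<in> set \<alpha>. count N a = count (mset \<alpha>) a)"
  proof (intro iffI)
    assume count: "\<forall>a \<in> set \<alpha>. count N a = count (mset \<alpha>) a"
    have "mset \<alpha> \<subseteq># N"
    proof (rule mset_subset_eqI)
      fix a show "count (mset \<alpha>) a \<le> count N a"
        using count by (metis count_mset_0_iff order_refl zero_le)
    qed
    moreover have "size N \<le> size (mset \<alpha>)"
      using size_proots_le[of p] p \<alpha> by (simp add: N_def decreasing_pos_tuple_def)
    ultimately show "N = mset \<alpha>"
      using mset_subset_size[of "mset \<alpha>" N] by (metis not_less subset_mset.le_neq_trans)
  qed simp
  finally show ?thesis using order by simp
qed

lemma order_0_pcompose_shift:
  fixes p :: "'a::idom poly"
  assumes "p \<noteq> 0"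
  shows "Polynomial.order 0 (p \<circ>\<^sub>p [:a, 1:]) = Polynomial.order a p"
proof -
  obtain q where q: "p = [:- a, 1:] ^ Polynomial.order a p * q" "\<not> [:- a, 1:] dvd q"
    using order_decomp[OF assms] by blast
  let ?k = "Polynomial.order a p"
  have qa: "poly (q \<circ>\<^sub>p [:a, 1:]) 0 \<noteq> 0"
    using q(2) by (simp add: poly_pcompose poly_eq_0_iff_dvd)
  then have q0: "q \<circ>\<^sub>p [:a, 1:] \<noteq> 0" by auto
  have "[:- a, 1:] \<circ>\<^sub>p [:a, 1:] = [:-0, 1:]" by (simp add: pcompose_pCons)
  then have "p \<circ>\<^sub>p [:a, 1:] = [:-0, 1:] ^ ?k * (q \<circ>\<^sub>p [:a, 1:])"
    by (subst q(1)) (simp only: pcompose_mult pcompose_hom.hom_power)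
  then have "Polynomial.order 0 (p \<circ>\<^sub>p [:a, 1:]) = ?k + Polynomial.order 0 (q \<circ>\<^sub>p [:a, 1:])"
    using q0 order_power_n_n[of "0 :: 'a" ?k]
    by (metis minus_zero mult_eq_0_iff order_mult pCons_eq_0_iff power_not_zero zero_neq_one)
  then show ?thesis using qa by (simp add: order_0I)
qed

lemma pcompose_subst3:
  "subst3 F p q r \<circ>\<^sub>p s = subst3 F (p \<circ>\<^sub>p s) (q \<circ>\<^sub>p s) (r \<circ>\<^sub>p s)"
  by (simp add: subst3_def case_prod_unfold pcompose_sum pcompose_smult pcompose_mult pcompose_hom.hom_power)

text \<open>
  In the parametrisation used by \<open>line_mult\<close> the point belonging to \<open>a\<close> sits at parameter 0,
  while on the coordinate line it has coordinate $a^2$; this accounts for the shift of \<open>p\<close>.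
\<close>

lemma passes_through_iff_sqrt_zeros:
  assumes \<alpha>: "decreasing_pos_tuple n \<alpha>" and p: "p \<noteq> 0" "degree p = n"
    and mult: "\<And>a. line_mult F (f a) q = Polynomial.order 0 (p \<circ>\<^sub>p [:a\<^sup>2, 1:])"
    and inj: "\<And>a b. a > 0 \<Longrightarrow> b > 0 \<Longrightarrow> proj_eq (f a) (f b) \<longleftrightarrow> a = b"
  shows "passes_through_on_line F q (map f \<alpha>) \<longleftrightarrow> sqrt_zeros p = \<alpha>"
proof -
  have pos: "a > 0" if "a \<in> set \<alpha>" for a
    using \<alpha> that by (simp add: decreasing_pos_tuple_def)
  have "length (filter (proj_eq (f a)) (map f \<alpha>)) = count (mset \<alpha>) a" if a: "a \<in> set \<alpha>" for a
  proof -
    have "filter (proj_eq (f a) \<circ> f) \<alpha> = filter ((=) a) \<alpha>"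
      by (rule filter_cong) (use inj pos a in auto)
    then show ?thesis by (simp add: filter_map count_mset count_list_eq_length_filter)
  qed
  then show ?thesis
    unfolding sqrt_zeros_eq_iff_order[OF \<alpha> p] passes_through_on_line_def
    by (auto simp: mult order_0_pcompose_shift[OF p(1)])
qed

lemma line_mult_scale:
  "c \<noteq> 0 \<Longrightarrow> line_mult (const3 c * F) p q = line_mult F p q"
  by (cases p; cases q) (simp add: subst3_mult subst3_const3 order_smult)

lemma vinnikov_passes_through_iff:
  assumes "edges_nondegenerate n F"
    and "decreasing_pos_tuple n \<alpha>" "decreasing_pos_tuple n \<beta>" "decreasing_pos_tuple n \<gamma>"
  shows "passes_through_on_line F (0, 1, 0) (map (\<lambda>a. (-1, a\<^sup>2, 0)) \<alpha>) \<and>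
      passes_through_on_line F (0, 0, 1) (map (\<lambda>b. (0, -1, b\<^sup>2)) \<beta>) \<and>
      passes_through_on_line F (1, 0, 0) (map (\<lambda>c. (c\<^sup>2, 0, -1)) \<gamma>) \<longleftrightarrow>
    boundary F = (\<alpha>, \<beta>, \<gamma>)"
proof -
  have edges: "subst3 F (-1) [:0, 1:] 0 \<noteq> 0" "degree (subst3 F (-1) [:0, 1:] 0) = n"
    "subst3 F 0 (-1) [:0, 1:] \<noteq> 0" "degree (subst3 F 0 (-1) [:0, 1:]) = n"
    "subst3 F [:0, 1:] 0 (-1) \<noteq> 0" "degree (subst3 F [:0, 1:] 0 (-1)) = n"
    using assms(1) by (simp_all add: edges_nondegenerate_def)
  have minus: "(-1 :: real poly) \<circ>\<^sub>p s = [:-1:]" for s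
    by (simp add: one_pCons pcompose_pCons)
  show ?thesis
    unfolding boundary_def Let_def prod.inject
    by (intro arg_cong2[of _ _ _ _ "(\<and>)"]
        passes_through_iff_sqrt_zeros[OF assms(2) edges(1,2)]
        passes_through_iff_sqrt_zeros[OF assms(3) edges(3,4)]
        passes_through_iff_sqrt_zeros[OF assms(4) edges(5,6)])
      (auto simp: pcompose_subst3 minus pcompose_pCons proj_eq_def)
qed

theorem mainTheorem2:
  fixes n :: nat and \<alpha> \<beta> \<gamma> :: "real list"
  assumes "decreasing_pos_tuple n \<alpha>"
    and "decreasing_pos_tuple n \<beta>"
    and "decreasing_pos_tuple n \<gamma>"
  shows "(horn_multiplicative_solvable n \<alpha> \<beta> \<gamma> \<longleftrightarrow>
            (\<exists>F \<in> vinnikov_polys n. boundary F = (\<alpha>, \<beta>, \<gamma>))) \<and>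
         (horn_multiplicative_solvable n \<alpha> \<beta> \<gamma> \<longleftrightarrow>
            (\<exists>F. vinnikov_curve n F \<and>
              passes_through_on_line F (0, 1, 0) (map (\<lambda>a. (-1, a\<^sup>2, 0)) \<alpha>) \<and>
              passes_through_on_line F (0, 0, 1) (map (\<lambda>b. (0, -1, b\<^sup>2)) \<beta>) \<and>
              passes_through_on_line F (1, 0, 0) (map (\<lambda>c. (c\<^sup>2, 0, -1)) \<gamma>)))"
    (is "_ \<and> (_ \<longleftrightarrow> (\<exists>F. _ \<and> ?passes F))")
proof (intro conjI)
  show horn: "horn_multiplicative_solvable n \<alpha> \<beta> \<gamma> \<longleftrightarrow>
      (\<exists>F \<in> vinnikov_polys n. boundary F = (\<alpha>, \<beta>, \<gamma>))"
    by (rule horn_iff_boundary)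
  have passes: "?passes F \<longleftrightarrow> boundary F = (\<alpha>, \<beta>, \<gamma>)" if "F \<in> vinnikov_polys n" for F
  proof -
    have "edges_nondegenerate n F" by (rule vinnikov_polys_to_matrices[OF that])
    then show ?thesis by (rule vinnikov_passes_through_iff[OF _ assms])
  qed
  have scale: "?passes (const3 c * F) \<longleftrightarrow> ?passes F" if "c \<noteq> 0" for c F
    by (simp add: passes_through_on_line_def line_mult_scale[OF that] del: line_mult.simps)
  have "(\<exists>F. vinnikov_curve n F \<and> ?passes F) \<longleftrightarrow> (\<exists>F \<in> vinnikov_polys n. ?passes F)"
  proof
    assume "\<exists>F. vinnikov_curve n F \<and> ?passes F"
    then obtain c G where "c \<noteq> 0" "G \<in> vinnikov_polys n" "?passes (const3 c * G)"
      unfolding vinnikov_curve_def by blast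
    then show "\<exists>F \<in> vinnikov_polys n. ?passes F"
      unfolding scale[OF \<open>c \<noteq> 0\<close>] by blast
  next
    assume "\<exists>F \<in> vinnikov_polys n. ?passes F"
    then obtain F where F: "F \<in> vinnikov_polys n" "?passes F" by blast
    have "vinnikov_curve n (const3 1 * F)"
      unfolding vinnikov_curve_def using F(1) by (intro exI[of _ 1] exI[of _ F]) simp
    moreover have "?passes (const3 1 * F)"
      unfolding scale[OF one_neq_zero] by (rule F(2))
    ultimately show "\<exists>F. vinnikov_curve n F \<and> ?passes F" by blast
  qed
  then show "horn_multiplicative_solvable n \<alpha> \<beta> \<gamma> \<longleftrightarrow> (\<exists>F. vinnikov_curve n F \<and> ?passes F)"
    using horn passes by (metis (lifting))
qed

end
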